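(* Let $V$ be a compact Hausdorff space, let $\{\alpha_n\}_{n\in\mathbb{N}}$ be a sequence of finite open covers of $V$ with $\alpha_{n+1}\succ\alpha_n$ for every $n$, and let $\{c(n)\}_{n\in\mathbb{N}}$ be a strictly increasing sequence of positive real numbers going to infinity. Assume that for some finite $k\in\mathbb{N}$ the sequence $\{c(n)\}_{n\in\mathbb{N}}$ controls the simplicial growth of $\{K(\alpha_n)\}_{n\in\mathbb{N}}$ up to dimension $k$. Then $\{c(n)\}_{n\in\mathbb{N}}$ controls the simplicial growth of $\{K(\alpha_n)\}_{n\in\mathbb{N}}$ up to dimension $k$ for every finite $k\in\mathbb{N}$.
   Context: $\mathcal{C}_V$ denotes the set of finite open covers of $V$. For $\alpha,\beta\in\mathcal{C}_V$ write $\beta\succ\alpha$ ("$\beta$ is finer than $\alpha$") if every member of $\beta$ is contained in some member of $\alpha$. The nerve $K(\alpha)$ of $\alpha=\{A_i\mid i\in I\}$ is the simplicial complex with one $0$-simplex $[a_i]$ for each $A_i$, and whose $k$-simplices are the $[a_{i(0)},\dots,a_{i(k)}]$ ($i(0),\dots,i(k)$ distinct, up to permutation) with $\bigcap_{r=0}^k A_{i(r)}\neq\emptyset$. $\triangle_k(\alpha)$ is the set of $k$-simplices of $K(\alpha)$ and $|\triangle_k(\alpha)|$ its cardinality. Define $$\mathcal{G}_k(\alpha):=\sum_{i=0}^k|\triangle_i(\alpha)|,\qquad S_k(\alpha):=\min_{\beta\succ\alpha}\mathcal{G}_k(\beta).$$ The sequence $\{c(n)\}$ is said to control the simplicial growth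 of $\{K(\alpha_n)\}_{n}$ up to dimension $k$ if $$0<\liminf_{n}\frac{\log S_k(\alpha_n)}{c(n)}\le\limsup_{n}\frac{\log S_k(\alpha_n)}{c(n)}<\infty.$$ *)

theory Defs
  imports "HOL-Analysis.Analysis"
begin

definition finite_open_covers :: "'a topology \<Rightarrow> 'a set set set" where
  "finite_open_covers V =
     {\<alpha>. finite \<alpha> \<and> (\<forall>A\<in>\<alpha>. openin V A) \<and> \<Union>\<alpha> = topspace V}"

definition finer :: "'a set set \<Rightarrow> 'a set set \<Rightarrow> bool" (infix "\<succ>" 50) where
  "\<beta> \<succ> \<alpha> \<longleftrightarrow> (\<forall>B\<in>\<beta>. \<exists>A\<in>\<alpha>. B \<subseteq> A)"

text \<open>
  The \<open>k\<close>-simplices of the nerve. A simplex is identified with its set of vertices, and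
  a vertex with the member of the cover that it stands for. Every member gives a vertex,
  hence the case \<open>k = 0\<close>, which only matters if the empty set is a member.
\<close>

definition nerve_simplices :: "nat \<Rightarrow> 'a set set \<Rightarrow> 'a set set set" where
  "nerve_simplices k \<alpha> = {\<sigma>. \<sigma> \<subseteq> \<alpha> \<and> card \<sigma> = k + 1 \<and> (k = 0 \<or> \<Inter>\<sigma> \<noteq> {})}"

definition simplex_count :: "nat \<Rightarrow> 'a set set \<Rightarrow> nat" where
  "simplex_count k \<alpha> = (\<Sum>i=0..k. card (nerve_simplices i \<alpha>))"

definition min_simplex_count :: "'a topology \<Rightarrow> nat \<Rightarrow> 'a set set \<Rightarrow> nat" where
  "min_simplex_count V k \<alpha> = (INF \<beta> \<in> {\<beta> \<in> finite_open_covers V. \<beta> \<succ> \<alpha>}. simplex_count k \<beta>)"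

text \<open>The infimum of natural numbers is a minimum here, since \<open>\<alpha> \<succ> \<alpha>\<close>.\<close>

lemma min_simplex_count_attained:
  assumes "\<alpha> \<in> finite_open_covers V"
  shows "\<exists>\<beta> \<in> finite_open_covers V. \<beta> \<succ> \<alpha> \<and> simplex_count k \<beta> = min_simplex_count V k \<alpha>"
proof -
  have "simplex_count k ` {\<beta> \<in> finite_open_covers V. \<beta> \<succ> \<alpha>} \<noteq> {}"
    using assms by (auto simp: finer_def)
  then have "min_simplex_count V k \<alpha> \<in> simplex_count k ` {\<beta> \<in> finite_open_covers V. \<beta> \<succ> \<alpha>}"
    unfolding min_simplex_count_def by (rule Inf_nat_def1)
  then show ?thesis by auto
qed

lemma min_simplex_count_le:
  assumes "\<beta> \<in> finite_open_covers V" "\<beta> \<succ> \<alpha>"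
  shows "min_simplex_count V k \<alpha> \<le> simplex_count k \<beta>"
  unfolding min_simplex_count_def using assms by (intro cINF_lower) auto

text \<open>
  The limits are taken in the extended reals. The convention \<open>ln 0 = 0\<close> plays a role only
  for the empty space, where all minimal counts are \<open>0\<close>; there the lower bound fails,
  as it would with \<open>ln 0 = -\<infinity>\<close>.
\<close>

definition controls_simplicial_growth ::
    "'a topology \<Rightarrow> (nat \<Rightarrow> real) \<Rightarrow> (nat \<Rightarrow> 'a set set) \<Rightarrow> nat \<Rightarrow> bool" where
  "controls_simplicial_growth V c \<alpha> k \<longleftrightarrow>
     0 < liminf (\<lambda>n. ereal (ln (real (min_simplex_count V k (\<alpha> n))) / c n)) \<and>
     liminf (\<lambda>n. ereal (ln (real (min_simplex_count V k (\<alpha> n))) / c n))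
       \<le> limsup (\<lambda>n. ereal (ln (real (min_simplex_count V k (\<alpha> n))) / c n)) \<and>
     limsup (\<lambda>n. ereal (ln (real (min_simplex_count V k (\<alpha> n))) / c n)) < \<infinity>"

end

theory Submission
  imports Defs
begin

text \<open>
  A simplex of dimension at most \<open>k\<close> has at most \<open>k + 1\<close> vertices, so a nerve with \<open>N\<close> vertices
  has at most \<open>N ^ (k + 1)\<close> such simplices (lemma \<open>simplex_count_le_power\<close>); and it has at least
  the \<open>N\<close> vertices themselves. Both bounds pass to the minima over refinements: with \<open>S\<^sub>k\<close> for the
  minimal count,
  \<open>S\<^sub>0 \<le> S\<^sub>k \<le> S\<^sub>0 ^ (k + 1)\<close>, where the second bound comes from a refinement that is optimal for
  \<open>S\<^sub>0\<close>. Hence \<open>S\<^sub>k \<le> S\<^sub>j ^ (k + 1)\<close> for all \<open>j\<close> and \<open>k\<close>, so that the logarithms of \<open>S\<^sub>k\<close>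
  and \<open>S\<^sub>j\<close> are bounded by constant multiples of each other (lemma
  \<open>ln_min_simplex_count_comparison\<close>). Positivity of the lower limit and finiteness of the upper
  limit are insensitive to such multiples.
\<close>

lemma nonempty_set_eq_set_of_length:
  assumes "finite \<sigma>" "\<sigma> \<noteq> {}" "card \<sigma> \<le> m"
  obtains xs where "set xs = \<sigma>" "length xs = m"
proof -
  obtain ys where ys: "set ys = \<sigma>" "distinct ys"
    using finite_distinct_list[OF assms(1)] by blast
  then have "length ys \<le> m" "hd ys \<in> \<sigma>"
    using assms distinct_card[of ys] hd_in_set[of ys] by auto
  then have "set (ys @ replicate (m - length ys) (hd ys)) = \<sigma>"
    and "length (ys @ replicate (m - length ys) (hd ys)) = m"
    using ys by (auto simp: set_replicate_conv_if)
  then show ?thesis by (rule that)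
qed

lemma finite_nerve_simplices: "finite \<alpha> \<Longrightarrow> finite (nerve_simplices k \<alpha>)"
  unfolding nerve_simplices_def by simp

lemma simplex_count_mono: "j \<le> k \<Longrightarrow> simplex_count j \<alpha> \<le> simplex_count k \<alpha>"
  unfolding simplex_count_def by (rule sum_mono2) auto

lemma simplex_count_0: "simplex_count 0 \<alpha> = card \<alpha>"
proof -
  have "nerve_simplices 0 \<alpha> = (\<lambda>A. {A}) ` \<alpha>"
    by (auto simp: nerve_simplices_def card_1_singleton_iff)
  then show ?thesis
    by (simp add: simplex_count_def card_image)
qed

text \<open>
  The lists of length \<open>k + 1\<close> over the cover list the vertices of every simplex of dimension at
  most \<open>k\<close>, because repetitions are permitted. Counting lists rather than binomial coefficients
  gives a pure power, with no constant factor that would have to be absorbed in the limit.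
\<close>

lemma simplex_count_le_power:
  assumes "finite \<alpha>"
  shows "simplex_count k \<alpha> \<le> simplex_count 0 \<alpha> ^ (k + 1)"
proof -
  let ?L = "{xs. set xs \<subseteq> \<alpha> \<and> length xs = k + 1}"
  have "simplex_count k \<alpha> = card (\<Union>i\<in>{0..k}. nerve_simplices i \<alpha>)"
    unfolding simplex_count_def using assms
    by (intro card_UN_disjoint[symmetric])
       (auto simp: finite_nerve_simplices, auto simp: nerve_simplices_def)
  also have "\<dots> \<le> card (set ` ?L)"
  proof (rule card_mono)
    show "finite (set ` ?L)"
      using assms by (simp add: finite_lists_length_eq)
    show "(\<Union>i\<in>{0..k}. nerve_simplices i \<alpha>) \<subseteq> set ` ?L"
    proof
      fix \<sigma> assume "\<sigma> \<in> (\<Union>i\<in>{0..k}. nerve_simplices i \<alpha>)"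
      then have \<sigma>: "\<sigma> \<subseteq> \<alpha>" "card \<sigma> \<le> k + 1" "\<sigma> \<noteq> {}"
        by (auto simp: nerve_simplices_def)
      then obtain xs where "set xs = \<sigma>" "length xs = k + 1"
        using nonempty_set_eq_set_of_length assms finite_subset by metis
      with \<sigma>(1) show "\<sigma> \<in> set ` ?L" by auto
    qed
  qed
  also have "\<dots> \<le> card ?L"
    using assms by (intro card_image_le finite_lists_length_eq)
  also have "\<dots> = simplex_count 0 \<alpha> ^ (k + 1)"
    using assms by (simp only: card_lists_length_eq simplex_count_0)
  finally show ?thesis .
qed

lemma min_simplex_count_le_power:
  assumes "\<alpha> \<in> finite_open_covers V"
  shows "min_simplex_count V k \<alpha> \<le> min_simplex_count V j \<alpha> ^ (k + 1)"
proof -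
  obtain \<beta> where \<beta>: "\<beta> \<in> finite_open_covers V" "\<beta> \<succ> \<alpha>"
      "simplex_count 0 \<beta> = min_simplex_count V 0 \<alpha>"
    using min_simplex_count_attained[OF assms] by blast
  obtain \<gamma> where \<gamma>: "\<gamma> \<in> finite_open_covers V" "\<gamma> \<succ> \<alpha>"
      "simplex_count j \<gamma> = min_simplex_count V j \<alpha>"
    using min_simplex_count_attained[OF assms] by blast
  have "min_simplex_count V 0 \<alpha> \<le> min_simplex_count V j \<alpha>"
    using min_simplex_count_le[OF \<gamma>(1,2), of 0] simplex_count_mono[of 0 j \<gamma>] \<gamma>(3) by simp
  have "min_simplex_count V k \<alpha> \<le> simplex_count k \<beta>"
    by (rule min_simplex_count_le[OF \<beta>(1,2)])
  also have "\<dots> \<le> min_simplex_count V 0 \<alpha> ^ (k + 1)"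
    using simplex_count_le_power[of \<beta> k] \<beta>(1,3) by (simp add: finite_open_covers_def)
  also have "\<dots> \<le> min_simplex_count V j \<alpha> ^ (k + 1)"
    by (rule power_mono) (use \<open>min_simplex_count V 0 \<alpha> \<le> _\<close> in auto)
  finally show ?thesis .
qed

text \<open>
  For the empty space all minimal counts vanish, and the inequality persists because
  \<open>ln 0 = 0\<close>.
\<close>

lemma ln_min_simplex_count_comparison:
  assumes "\<alpha> \<in> finite_open_covers V"
  shows "ln (real (min_simplex_count V k \<alpha>))
           \<le> real (k + 1) * ln (real (min_simplex_count V j \<alpha>))"
proof (cases "min_simplex_count V k \<alpha> = 0")
  case True
  then show ?thesis
    by (cases "min_simplex_count V j \<alpha> = 0") auto
next
  case False
  have le: "real (min_simplex_count V k \<alpha>) \<le> real (min_simplex_count V j \<alpha>) ^ (k + 1)"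
    using min_simplex_count_le_power[OF assms] by (metis of_nat_le_iff of_nat_power)
  with False have pos: "min_simplex_count V j \<alpha> > 0"
    by (cases "min_simplex_count V j \<alpha> = 0") auto
  from le False have "ln (real (min_simplex_count V k \<alpha>))
      \<le> ln (real (min_simplex_count V j \<alpha>) ^ (k + 1))"
    by (intro ln_mono) auto
  also have "\<dots> = real (k + 1) * ln (real (min_simplex_count V j \<alpha>))"
    by (rule ln_realpow)
  finally show ?thesis .
qed

lemma controls_simplicial_growth_transfer:
  assumes cover: "\<And>n. \<alpha> n \<in> finite_open_covers V"
    and pos: "\<And>n. 0 < c n"
    and control: "controls_simplicial_growth V c \<alpha> j"
  shows "controls_simplicial_growth V c \<alpha> k"
proof -
  define r where "r = (\<lambda>i n. ereal (ln (real (min_simplex_count V i (\<alpha> n))) / c n))"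
  have r_le: "r i n \<le> ereal (real (i + 1)) * r l n" for i l n
    using divide_right_mono[OF ln_min_simplex_count_comparison[OF cover], of "c n" i n l] pos[of n]
    by (simp add: r_def)
  have "0 < liminf (r j)" "limsup (r j) < \<infinity>"
    using control by (simp_all add: controls_simplicial_growth_def r_def)
  \<comment> \<open>The comparison is used in both directions: with \<open>j\<close> on the left for the lower limit, with
    \<open>k\<close> on the left for the upper limit.\<close>
  have "liminf (r j) \<le> liminf (\<lambda>n. ereal (real (j + 1)) * r k n)"
    by (intro Liminf_mono always_eventually allI r_le)
  also have "\<dots> = ereal (real (j + 1)) * liminf (r k)"
    by (rule Liminf_ereal_mult_left) auto
  finally have "0 < ereal (real (j + 1)) * liminf (r k)"
    using \<open>0 < liminf (r j)\<close> by (rule less_le_trans[rotated])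
  then have lower: "0 < liminf (r k)"
    by (cases "liminf (r k)") (auto simp: zero_less_mult_iff)
  have "limsup (r k) \<le> limsup (\<lambda>n. ereal (real (k + 1)) * r j n)"
    by (intro Limsup_mono always_eventually allI r_le)
  also have "\<dots> = ereal (real (k + 1)) * limsup (r j)"
    by (rule Limsup_ereal_mult_left) auto
  also have "\<dots> < \<infinity>"
    using \<open>limsup (r j) < \<infinity>\<close> by (cases "limsup (r j)") auto
  finally have upper: "limsup (r k) < \<infinity>" .
  have "liminf (r k) \<le> limsup (r k)"
    by (simp add: Liminf_le_Limsup)
  with lower upper show ?thesis
    by (simp add: controls_simplicial_growth_def r_def)
qed

theorem theorem1:
  fixes V :: "'a topology"
    and \<alpha> :: "nat \<Rightarrow> 'a set set"
    and c :: "nat \<Rightarrow> real"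
  assumes "compact_space V" and "Hausdorff_space V"
    and "\<And>n. \<alpha> n \<in> finite_open_covers V"
    and "\<And>n. \<alpha> (Suc n) \<succ> \<alpha> n"
    and "strict_mono c" and "\<And>n. 0 < c n" and "filterlim c at_top sequentially"
    and "\<exists>k. controls_simplicial_growth V c \<alpha> k"
  shows "\<forall>k. controls_simplicial_growth V c \<alpha> k"
  using controls_simplicial_growth_transfer[of \<alpha> V c] assms(3,6,8) by blast

end
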